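(* Let $F_h=L_h+R_h$ and let $(x_{h,k})_{k\in\mathbb N}$, $(y_{h,k})_{k\in\mathbb N}$ be generated by the IML FISTA iteration described in the context, with the Type $0$ approximation of the proximity operator ($i=0$), from an arbitrary $x_{h,0}\in\mathbb R^{N_h}$. Suppose that: (1) $\alpha_{h,k}=0$ for all $k\in\mathbb N^*$ (so that there is no inertia); (2) $\nabla L_h$ is $\beta_h$-Lipschitz and $\nabla L_H$ is $\beta_H$-Lipschitz, at most $p$ coarse corrections are computed over the whole run, and the step sizes at the fine and coarse levels $\tau_h,\tau_H\in(0,+\infty)$ satisfy $\tau_h<\beta_h^{-1}$ and $\tau_H<\beta_H^{-1}$; (3) $\sum_{k\in\mathbb N}\sqrt{|\epsilon_{h,k}|}<+\infty$. Then the sequence $(x_{h,k})_{k\in\mathbb N}$ converges to a minimizer of $F_h$.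
   Context: Fine level: $L_h,R_h:\mathbb R^{N_h}\to(-\infty,+\infty]$ are convex, lower semicontinuous and proper; $L_h$ is differentiable with $\beta_h$-Lipschitz gradient; $F_h=L_h+R_h$ is coercive. Coarse level: $N_H<N_h$; $L_H,R_H:\mathbb R^{N_H}\to(-\infty,+\infty]$ are lower-dimensional approximations of $L_h,R_h$, in the same class (convex, l.s.c., proper), with $L_H$ differentiable with $\beta_H$-Lipschitz gradient. $I_h^H:\mathbb R^{N_h}\to\mathbb R^{N_H}$ and $I_H^h:\mathbb R^{N_H}\to\mathbb R^{N_h}$ are linear operators with $I_H^h=\nu (I_h^H)^T$ for some $\nu>0$. Smoothing: for a convex, l.s.c., proper $R$ and $\gamma>0$, a convex continuously differentiable function $R_\gamma$ is a smoothed convex approximation of $R$ if there are finite scalars $\eta_1,\eta_2$ with $\eta_1+\eta_2>0$ and $R(y)-\eta_1\gamma\le R_\gamma(y)\le R(y)+\eta_2\gamma$ for all $y$. Let $R_{h,\gamma_h}$, $R_{H,\gamma_H}$ be such approximations of $R_h$, $R_H$ ($\gamma_h,\gamma_H>0$). Coarse model at iteration $k$: $F_H=L_H+R_{H,\gamma_H}+\langle v_{H,k},\cdot\rangle$ with $v_{H,k}=I_h^H(\nabla L_h(y_{h,k})+\nabla R_{h,\gamma_h}(y_{h,k}))-(\nabla L_H(I_h^Hy_{h,k})+\nabla R_{H,\gamma_H}(I_h^Hy_{h,k}))$. Coarse iterations: $m>0$ is an integer and the operators $\Phi_{H,\ell}$ on $\mathbb R^{N_H}$ (they may implicitly depend on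 $k$, and use step size $\tau_H$) are such that, with $s_{H,k,0}=I_h^Hy_{h,k}$ and $s_{H,k,m}=\Phi_{H,m-1}\circ\cdots\circ\Phi_{H,0}(s_{H,k,0})$, one has $F_H(s_{H,k,m})\le F_H(s_{H,k,0})$, and $s_{H,k,m}-s_{H,k,0}$ is bounded. IML FISTA iteration: start from $x_{h,0},y_{h,0}\in\mathbb R^{N_h}$, $t_{h,0}=1$. For $k=0,1,\dots$: either (coarse correction; done at most $p$ times over the whole run) choose $\bar\tau_{h,k}>0$ and set $\bar y_{h,k}=y_{h,k}+\bar\tau_{h,k}I_H^h(s_{H,k,m}-s_{H,k,0})$, or set $\bar y_{h,k}=y_{h,k}$. Then take $x_{h,k+1}\approx_{i,\epsilon_{h,k}}\mathrm{prox}_{\tau_hR_h}(\bar y_{h,k}-\tau_h\nabla L_h(\bar y_{h,k}))$, and $y_{h,k+1}=x_{h,k+1}+\alpha_{h,k}(x_{h,k+1}-x_{h,k})$, where in the general algorithm $\alpha_{h,k}=(t_{h,k}-1)/t_{h,k+1}$ (so $\alpha_{h,0}=0$). Type $0$ approximation: for $\gamma>0$, $\epsilon\ge0$, $z\approx_{0,\epsilon}\mathrm{prox}_{\gamma R}(y)$ means $\|z-\mathrm{prox}_{\gamma R}(y)\|\le\sqrt{2\gamma\epsilon}$, where $\mathrm{prox}_{\gamma R}(y)=\arg\min_x R(x)+\frac1{2\gamma}\|x-y\|^2$. *)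

theory Defs
  imports "HOL-Analysis.Analysis"
begin

(* Extended-valued functions R^N -> (-oo,+oo] are rendered with type ereal. The conjunct
   f x \<noteq> -\<infinity> expresses the codomain, so that the ereal sums below never meet \<infinity> + -\<infinity>;
   for u = 0 the convention 0 * \<infinity> = 0 makes the convexity inequality trivial, as intended. *)

definition convex_lsc_proper :: "('a::euclidean_space \<Rightarrow> ereal) \<Rightarrow> bool" where
  "convex_lsc_proper f \<longleftrightarrow>
     (\<forall>x. f x \<noteq> -\<infinity>) \<and>
     (\<forall>x y. \<forall>u\<ge>0. \<forall>v\<ge>0. u + v = 1 \<longrightarrow>
        f (u *\<^sub>R x + v *\<^sub>R y) \<le> ereal u * f x + ereal v * f y) \<and>
     (\<forall>x. f x \<le> Liminf (at x) f) \<and>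
     (\<exists>x. f x \<noteq> \<infinity>)"

definition coercive :: "('a::euclidean_space \<Rightarrow> ereal) \<Rightarrow> bool" where
  "coercive f \<longleftrightarrow> (f \<longlongrightarrow> \<infinity>) at_infinity"

definition gradient :: "('a::euclidean_space \<Rightarrow> real) \<Rightarrow> 'a \<Rightarrow> 'a" where
  "gradient f x = (THE D. GDERIV f x :> D)"

(* Differentiability of an extended-valued function on the whole space includes finiteness;
   egradient is only meaningful where the function is finite near the point. *)

definition egradient :: "('a::euclidean_space \<Rightarrow> ereal) \<Rightarrow> 'a \<Rightarrow> 'a" where
  "egradient f = gradient (\<lambda>x. real_of_ereal (f x))"

definition differentiable_lipschitz_gradient ::
    "real \<Rightarrow> ('a::euclidean_space \<Rightarrow> ereal) \<Rightarrow> bool" where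
  "differentiable_lipschitz_gradient \<beta> f \<longleftrightarrow>
     (\<forall>x. \<bar>f x\<bar> \<noteq> \<infinity>) \<and>
     (\<lambda>x. real_of_ereal (f x)) differentiable_on UNIV \<and>
     \<beta>-lipschitz_on UNIV (egradient f)"

definition smoothed_convex_approx ::
    "('a::euclidean_space \<Rightarrow> ereal) \<Rightarrow> real \<Rightarrow> ('a \<Rightarrow> real) \<Rightarrow> bool" where
  "smoothed_convex_approx R \<gamma> R\<gamma> \<longleftrightarrow>
     convex_on UNIV R\<gamma> \<and>
     R\<gamma> differentiable_on UNIV \<and> continuous_on UNIV (gradient R\<gamma>) \<and>
     (\<exists>\<eta>\<^sub>1 \<eta>\<^sub>2. \<eta>\<^sub>1 + \<eta>\<^sub>2 > 0 \<and>
        (\<forall>y. R y - ereal (\<eta>\<^sub>1 * \<gamma>) \<le> ereal (R\<gamma> y) \<and>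
             ereal (R\<gamma> y) \<le> R y + ereal (\<eta>\<^sub>2 * \<gamma>)))"

definition prox :: "real \<Rightarrow> ('a::euclidean_space \<Rightarrow> ereal) \<Rightarrow> 'a \<Rightarrow> 'a" where
  "prox \<gamma> R y = (ARG_MIN (\<lambda>x. R x + ereal (1 / (2 * \<gamma>) * (norm (x - y))\<^sup>2)) x. True)"

definition type0_approx_prox ::
    "real \<Rightarrow> real \<Rightarrow> ('a::euclidean_space \<Rightarrow> ereal) \<Rightarrow> 'a \<Rightarrow> 'a \<Rightarrow> bool" where
  "type0_approx_prox \<epsilon> \<gamma> R y z \<longleftrightarrow> norm (z - prox \<gamma> R y) \<le> sqrt (2 * \<gamma> * \<epsilon>)"

(* First-order coherence term v and coarse model F_H at the fine iterate y; P is the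
   fine-to-coarse transfer operator, Rh\<gamma> and RH\<gamma> are the smoothed versions of R_h and R_H. *)

definition coherence_term ::
    "('a::euclidean_space \<Rightarrow> ereal) \<Rightarrow> ('a \<Rightarrow> real) \<Rightarrow>
     ('b::euclidean_space \<Rightarrow> ereal) \<Rightarrow> ('b \<Rightarrow> real) \<Rightarrow> ('a \<Rightarrow> 'b) \<Rightarrow> 'a \<Rightarrow> 'b" where
  "coherence_term Lh Rh\<gamma> LH RH\<gamma> P y =
     P (egradient Lh y + gradient Rh\<gamma> y) - (egradient LH (P y) + gradient RH\<gamma> (P y))"

definition coarse_model ::
    "('a::euclidean_space \<Rightarrow> ereal) \<Rightarrow> ('a \<Rightarrow> real) \<Rightarrow>
     ('b::euclidean_space \<Rightarrow> ereal) \<Rightarrow> ('b \<Rightarrow> real) \<Rightarrow> ('a \<Rightarrow> 'b) \<Rightarrow> 'a \<Rightarrow> 'b \<Rightarrow> ereal" where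
  "coarse_model Lh Rh\<gamma> LH RH\<gamma> P y u =
     LH u + ereal (RH\<gamma> u) + ereal (coherence_term Lh Rh\<gamma> LH RH\<gamma> P y \<bullet> u)"

definition coarse_iterates ::
    "(nat \<Rightarrow> 'b \<Rightarrow> 'b) \<Rightarrow> nat \<Rightarrow> 'b \<Rightarrow> (nat \<Rightarrow> 'b) \<Rightarrow> bool" where
  "coarse_iterates \<Phi> m s0 s \<longleftrightarrow> s 0 = s0 \<and> (\<forall>l<m. s (Suc l) = \<Phi> l (s l))"

(* One run of IML FISTA with the Type 0 approximation. C is the set of iterations at which a
   coarse correction is performed, d k = s_{H,k,m} - s_{H,k,0} is the coarse displacement and Q
   the coarse-to-fine transfer operator. The initial points x 0 and y 0 are arbitrary; the
   inertia \<alpha> is a free parameter here. *)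

definition iml_fista_type0 ::
    "('a::euclidean_space \<Rightarrow> ereal) \<Rightarrow> ('a \<Rightarrow> ereal) \<Rightarrow> real \<Rightarrow> (nat \<Rightarrow> real) \<Rightarrow> (nat \<Rightarrow> real) \<Rightarrow>
     nat set \<Rightarrow> (nat \<Rightarrow> real) \<Rightarrow> ('b::euclidean_space \<Rightarrow> 'a) \<Rightarrow> (nat \<Rightarrow> 'b) \<Rightarrow>
     (nat \<Rightarrow> 'a) \<Rightarrow> (nat \<Rightarrow> 'a) \<Rightarrow> (nat \<Rightarrow> 'a) \<Rightarrow> bool" where
  "iml_fista_type0 L R \<tau> \<epsilon> \<alpha> C \<tau>bar Q d x y ybar \<longleftrightarrow>
     (\<forall>k. ybar k = (if k \<in> C then y k + \<tau>bar k *\<^sub>R Q (d k) else y k) \<and>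
          type0_approx_prox (\<epsilon> k) \<tau> R (ybar k - \<tau> *\<^sub>R egradient L (ybar k)) (x (Suc k)) \<and>
          y (Suc k) = x (Suc k) + \<alpha> k *\<^sub>R (x (Suc k) - x k))"

end

theory Submission
  imports Defs "HOL-Real_Asymp.Real_Asymp"
begin

text \<open>
Only finitely many coarse corrections occur and the inertia vanishes, so after finitely many steps
the run is an inexact forward-backward iteration with summable errors. Write $p_k$ for the exact
forward-backward point at $x_k$. The three-point inequality of the proximal step, the descent
lemma and the tangent inequality for $L$ give, for every $z$,
\[2\tau (F(p_k) - F(z)) + \|p_k - z\|^2 + (1 - \tau\beta) \|p_k - x_k\|^2 \le \|x_k - z\|^2.\]
For a minimizer $z$ this makes $(x_k)$ quasi-Fejer, so $\|x_k - z\|$ converges, $p_k - x_k \to 0$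
and $F(p_k) \to \min F$. By lower semicontinuity every cluster point is a minimizer, and the
distance to it converges, necessarily to $0$.

The proximal point exists without an affine minorant of $R$: from $F \ge \min F$ and the quadratic
upper bound on $L$ one gets a quadratic lower bound on $R$ with curvature $\beta < 1/\tau$.
\<close>

section \<open>Gradients, the descent lemma and the tangent inequality\<close>

lemma gderiv_gradient:
  fixes f :: "'a::euclidean_space \<Rightarrow> real"
  assumes "f differentiable (at x)"
  shows "GDERIV f x :> gradient f x"
proof -
  obtain f' where f': "(f has_derivative f') (at x)"
    using assms by (auto simp: differentiable_def)
  then have "linear f'"
    by (rule has_derivative_linear)
  \<comment> \<open>The Riesz vector of the derivative is its adjoint at 1. Uniqueness is shown next
    because \<open>gradient\<close> is a definite description.\<close>
  then have "f' = (\<lambda>h. h \<bullet> adjoint f' 1)"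
    by (simp add: adjoint_works)
  then have D: "GDERIV f x :> adjoint f' 1"
    using f' unfolding gderiv_def by metis
  have "D = D'" if "GDERIV f x :> D" "GDERIV f x :> D'" for D D'
    using has_derivative_unique[OF that[unfolded gderiv_def]]
    by (metis inner_commute vector_eq_rdot)
  with D show ?thesis
    unfolding gradient_def by (metis (mono_tags) theI)
qed

lemma gderiv_along_line:
  fixes f :: "'a::euclidean_space \<Rightarrow> real"
  assumes "GDERIV f (x + t *\<^sub>R d) :> D"
  shows "((\<lambda>t. f (x + t *\<^sub>R d)) has_real_derivative d \<bullet> D) (at t)"
proof -
  have "((\<lambda>t. x + t *\<^sub>R d) has_derivative (\<lambda>h. h *\<^sub>R d)) (at t)"
    by (auto intro!: derivative_eq_intros)
  from has_derivative_compose[OF this assms[unfolded gderiv_def]] show ?thesis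
    by (simp add: has_field_derivative_def mult_commute_abs)
qed

text \<open>Along the segment from x to y, \<open>\<phi>\<close> is f minus its linear term and the
  quadratic one. Cauchy-Schwarz and the Lipschitz bound make its derivative nonpositive, and the
  claim compares the endpoints.\<close>

lemma descent_lemma:
  fixes f :: "'a::euclidean_space \<Rightarrow> real"
  assumes der: "\<And>x. GDERIV f x :> g x"
    and lip: "\<And>x y. norm (g x - g y) \<le> \<beta> * norm (x - y)"
  shows "f y \<le> f x + g x \<bullet> (y - x) + \<beta> / 2 * (norm (y - x))\<^sup>2"
proof -
  define d where "d = y - x"
  define \<phi> where "\<phi> t = f (x + t *\<^sub>R d) - t * (g x \<bullet> d) - \<beta> / 2 * t\<^sup>2 * (norm d)\<^sup>2" for t
  have "\<phi> 1 \<le> \<phi> 0"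
  proof (rule DERIV_nonpos_imp_nonincreasing[where f = \<phi>])
    fix t :: real assume t: "0 \<le> t" "t \<le> 1"
    have "(\<phi> has_real_derivative
        d \<bullet> g (x + t *\<^sub>R d) - g x \<bullet> d - \<beta> * t * (norm d)\<^sup>2) (at t)"
      unfolding \<phi>_def
      by (auto intro!: derivative_eq_intros gderiv_along_line[OF der])
    moreover have "d \<bullet> g (x + t *\<^sub>R d) - g x \<bullet> d \<le> \<beta> * t * (norm d)\<^sup>2"
    proof -
      have "d \<bullet> g (x + t *\<^sub>R d) - g x \<bullet> d = (g (x + t *\<^sub>R d) - g x) \<bullet> d"
        by (simp add: inner_diff_left inner_diff_right inner_commute)
      also have "\<dots> \<le> norm (g (x + t *\<^sub>R d) - g x) * norm d"
        by (rule norm_cauchy_schwarz)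
      also have "\<dots> \<le> \<beta> * norm (x + t *\<^sub>R d - x) * norm d"
        by (intro mult_right_mono lip norm_ge_zero)
      finally show ?thesis
        using t by (simp add: power2_eq_square mult_ac)
    qed
    ultimately show "\<exists>y. DERIV \<phi> t :> y \<and> y \<le> 0"
      by (intro exI conjI) auto
  qed simp
  then show ?thesis
    by (simp add: \<phi>_def d_def)
qed

text \<open>Convexity bounds the difference quotients along the segment by \<open>f y - f x\<close>;
  the bound survives the limit t -> 0+.\<close>

lemma convex_on_above_tangent:
  fixes f :: "'a::euclidean_space \<Rightarrow> real"
  assumes "convex_on UNIV f" and der: "GDERIV f x :> D"
  shows "f x + D \<bullet> (y - x) \<le> f y"
proof -
  define d where "d = y - x"
  have "((\<lambda>t. f (x + t *\<^sub>R d)) has_real_derivative d \<bullet> D) (at 0)"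
    by (rule gderiv_along_line) (simp add: der)
  then have "(\<lambda>t. (f (x + t *\<^sub>R d) - f x) / t) \<midarrow>0\<rightarrow> d \<bullet> D"
    by (simp add: DERIV_def)
  then have lim: "((\<lambda>t. (f (x + t *\<^sub>R d) - f x) / t) \<longlongrightarrow> d \<bullet> D) (at_right 0)"
    by (rule filterlim_mono) (auto simp: at_le)
  have "\<forall>\<^sub>F t in at_right 0. (f (x + t *\<^sub>R d) - f x) / t \<le> f y - f x"
    using eventually_at_right_less[of 0] eventually_at_right_real[OF zero_less_one]
  proof eventually_elim
    case (elim t)
    have "x + t *\<^sub>R d = (1 - t) *\<^sub>R x + t *\<^sub>R y"
      by (simp add: d_def algebra_simps)
    then have "f (x + t *\<^sub>R d) \<le> (1 - t) * f x + t * f y"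
      using convex_onD[OF assms(1), of t x y] elim by simp
    then have "f (x + t *\<^sub>R d) - f x \<le> (f y - f x) * t"
      by (simp add: algebra_simps)
    then show ?case
      using elim by (simp add: pos_divide_le_eq)
  qed
  from tendsto_upperbound[OF lim this] have "d \<bullet> D \<le> f y - f x"
    by simp
  then show ?thesis
    by (simp add: d_def inner_commute)
qed

section \<open>Sequential lower semicontinuity, existence of minimizers, quasi-Fejer
  sequences\<close>

text \<open>This is sequential closedness of the epigraph. Carrying the upper bounds u avoids any
  liminf, and a continuous summand is simply moved over to u.\<close>

definition seq_lsc :: "('a::euclidean_space \<Rightarrow> ereal) \<Rightarrow> bool" where
  "seq_lsc f \<longleftrightarrow>
     (\<forall>X c u u0. X \<longlonglongrightarrow> c \<longrightarrow> u \<longlonglongrightarrow> u0 \<longrightarrow> (\<forall>n. f (X n) \<le> u n) \<longrightarrow> f c \<le> u0)"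

lemma seq_lscI:
  assumes "\<And>x. f x \<le> Liminf (at x) f"
  shows "seq_lsc f"
  unfolding seq_lsc_def
proof (intro allI impI)
  fix X c u u0
  assume X: "X \<longlonglongrightarrow> c" and u: "u \<longlonglongrightarrow> u0" and le: "\<forall>n. f (X n) \<le> u n"
  show "f c \<le> u0"
  proof (rule ccontr)
    assume "\<not> f c \<le> u0"
    then obtain a where a: "u0 < a" "a < f c"
      using dense by (metis not_le)
    then have "\<forall>\<^sub>F y in at c. a < f y"
      using assms[of c] by (metis le_Liminf_iff)
    \<comment> \<open>\<open>at c\<close> leaves out the point c, which X may visit;
      \<open>a < f c\<close> covers it.\<close>
    then have "\<forall>\<^sub>F y in nhds c. a < f y"
      using a(2) by (auto simp: eventually_at_filter elim!: eventually_mono)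
    then have "\<forall>\<^sub>F n in sequentially. a < f (X n)"
      using X by (rule eventually_compose_filterlim)
    moreover have "\<forall>\<^sub>F n in sequentially. u n < a"
      using u a(1) by (rule order_tendstoD)
    ultimately have "\<forall>\<^sub>F n in sequentially. False"
      proof eventually_elim
      case (elim n)
      have "f (X n) < a"
        using le elim(2) by (meson le_less_trans)
      with elim(1) show False
        by simp
    qed
    then show False
      by simp
  qed
qed

lemma seq_lsc_add_continuous:
  fixes q :: "'a::euclidean_space \<Rightarrow> real"
  assumes "seq_lsc f" "continuous_on UNIV q"
  shows "seq_lsc (\<lambda>x. f x + ereal (q x))"
  unfolding seq_lsc_def
proof (intro allI impI)
  fix X c u u0
  assume X: "X \<longlonglongrightarrow> c" and u: "u \<longlonglongrightarrow> u0" and le: "\<forall>n. f (X n) + ereal (q (X n)) \<le> u n"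
  have "(\<lambda>n. ereal (q (X n))) \<longlonglongrightarrow> ereal (q c)"
    using X assms(2) by (auto simp: continuous_on_eq_continuous_at intro: isCont_tendsto_compose)
  then have "(\<lambda>n. u n - ereal (q (X n))) \<longlonglongrightarrow> u0 - ereal (q c)"
    by (intro tendsto_diff_ereal_general u) auto
  moreover have "\<forall>n. f (X n) \<le> u n - ereal (q (X n))"
    using le by (simp add: ereal_le_minus)
  ultimately have "f c \<le> u0 - ereal (q c)"
    using assms(1) X unfolding seq_lsc_def by blast
  then show "f c + ereal (q c) \<le> u0"
    by (simp add: ereal_le_minus)
qed

text \<open>The direct method: a minimizing sequence ends up in a sublevel set, which coercivity
  bounds, and lower semicontinuity transfers the infimum to a cluster point.\<close>

lemma coercive_attains_min:
  assumes "seq_lsc f" "coercive f" "f x0 \<noteq> \<infinity>"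
  obtains z where "is_arg_min f (\<lambda>_. True) z"
proof -
  obtain u where u: "\<And>n. u n \<in> range f" "u \<longlonglongrightarrow> (INF x. f x)"
    using Inf_as_limit[of "range f"] by auto
  have "\<exists>x. f x = u n" for n
    using u(1)[of n] by auto
  then obtain X where X: "\<And>n. f (X n) = u n"
    by metis
  have "(INF x. f x) \<le> f x0"
    by (simp add: INF_lower)
  also have "f x0 < \<infinity>"
    using assms(3) by (simp add: less_top[symmetric] top_ereal_def)
  finally have "(INF x. f x) < \<infinity>" .
  then obtain a where a: "(INF x. f x) < a" "a < \<infinity>"
    using dense by blast
  have "\<forall>\<^sub>F y in at_infinity. a < f y"
    using assms(2) a(2) unfolding coercive_def by (rule order_tendstoD)
  then obtain b where b: "\<And>y. b \<le> norm y \<Longrightarrow> a < f y"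
    by (auto simp: eventually_at_infinity)
  have "\<forall>\<^sub>F n in sequentially. u n < a"
    using u(2) a(1) by (rule order_tendstoD)
  then obtain N where N: "\<And>n. n \<ge> N \<Longrightarrow> u n < a"
    by (auto simp: eventually_sequentially)
  have "norm (X (n + N)) \<le> b" for n
    using b[of "X (n + N)"] N[of "n + N"] X[of "n + N"] by force
  then have "bounded (range (\<lambda>n. X (n + N)))"
    by (auto simp: bounded_iff)
  then obtain c r where r: "strict_mono r" "((\<lambda>n. X (n + N)) \<circ> r) \<longlonglongrightarrow> c"
    using bounded_imp_convergent_subsequence by blast
  have "((\<lambda>n. u (n + N)) \<circ> r) \<longlonglongrightarrow> (INF x. f x)"
    by (rule LIMSEQ_subseq_LIMSEQ[OF LIMSEQ_ignore_initial_segment[OF u(2)] r(1)])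
  then have "f c \<le> (INF x. f x)"
    using assms(1) r(2) X unfolding seq_lsc_def comp_def by (metis order_refl)
  then have "is_arg_min f (\<lambda>_. True) c"
    by (auto simp: is_arg_min_def not_less intro: INF_lower2 order_trans)
  then show ?thesis
    by (rule that)
qed

text \<open>Subtracting the partial sums of e turns a into a decreasing sequence bounded below;
  adding the convergent partial sums back keeps convergence.\<close>

lemma quasi_fejer_convergent:
  fixes a e :: "nat \<Rightarrow> real"
  assumes "\<And>n. 0 \<le> a n" "\<And>n. 0 \<le> e n" "\<And>n. a (Suc n) \<le> a n + e n" "summable e"
  shows "convergent a"
proof -
  let ?b = "\<lambda>n. a n - (\<Sum>i<n. e i)"
  have "decseq ?b"
    by (rule decseq_SucI) (simp add: algebra_simps assms(3))
  moreover have "- suminf e \<le> ?b n" for n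
    using assms(1)[of n] sum_le_suminf[OF assms(4), of "{..<n}"] assms(2) by simp
  ultimately obtain l where "?b \<longlonglongrightarrow> l"
    by (elim decseq_convergent) auto
  from tendsto_add[OF this summable_LIMSEQ[OF assms(4)]] show ?thesis
    by (auto simp: convergent_def)
qed

section \<open>The proximal step: coercivity and the three-point inequality\<close>

lemma prox_objective_coercive:
  fixes l :: "'a::euclidean_space \<Rightarrow> real"
  assumes der: "\<And>x. GDERIV l x :> g x"
    and lip: "\<And>x y. norm (g x - g y) \<le> \<beta> * norm (x - y)"
    and \<tau>: "0 < \<tau>" "\<tau> * \<beta> < 1"
    and bd: "\<And>x. ereal c \<le> ereal (l x) + R x"
  shows "coercive (\<lambda>x. R x + ereal (1 / (2 * \<tau>) * (norm (x - w))\<^sup>2))"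
proof -
  \<comment> \<open>The curvature left from the proximal quadratic once the bound on l has used
    \<open>\<beta> / 2\<close>; it is positive exactly when
    \<open>\<tau> * \<beta> < 1\<close>.\<close>
  define \<kappa> where "\<kappa> = 1 / (2 * \<tau>) - \<beta> / 2"
  have \<kappa>: "\<kappa> > 0"
    using \<tau> by (simp add: \<kappa>_def field_simps)
  \<comment> \<open>Lower bound for the objective at distance r from w: R is at least
    \<open>c - l\<close>, and the descent lemma at w bounds l from above.\<close>
  define h where "h r = c - l w - norm (g w) * r + \<kappa> * r\<^sup>2" for r
  have "filterlim h at_top at_top"
    unfolding h_def using \<kappa> by real_asymp
  moreover have "filterlim (\<lambda>x. norm (x - w)) at_top at_infinity"
  proof (rule filterlim_at_top_mono)
    show "filterlim (\<lambda>x::'a. - norm w + norm x) at_top at_infinity"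
      by (rule filterlim_tendsto_add_at_top[OF tendsto_const filterlim_norm_at_top])
    show "\<forall>\<^sub>F x in at_infinity. - norm w + norm x \<le> norm (x - w)"
      using norm_triangle_ineq2[of _ w] by (intro always_eventually allI) (simp add: add.commute)
  qed
  ultimately have "filterlim (\<lambda>x. h (norm (x - w))) at_top at_infinity"
    by (rule filterlim_compose)
  then have lim: "((\<lambda>x. ereal (h (norm (x - w)))) \<longlongrightarrow> \<infinity>) at_infinity"
    by (simp add: tendsto_PInfty_eq_at_top)
  have "ereal (h (norm (x - w))) \<le> R x + ereal (1 / (2 * \<tau>) * (norm (x - w))\<^sup>2)" for x
  proof -
    have "l x \<le> l w + g w \<bullet> (x - w) + \<beta> / 2 * (norm (x - w))\<^sup>2"
      by (rule descent_lemma[OF der lip])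
    also have "g w \<bullet> (x - w) \<le> norm (g w) * norm (x - w)"
      by (rule norm_cauchy_schwarz)
    finally have "h (norm (x - w)) \<le> c - l x + 1 / (2 * \<tau>) * (norm (x - w))\<^sup>2"
      by (simp add: h_def \<kappa>_def algebra_simps)
    moreover have "ereal (c - l x) \<le> R x"
      using bd[of x] by (cases "R x") auto
    ultimately show ?thesis
      by (cases "R x") auto
  qed
  then have "\<forall>\<^sub>F x in at_infinity. ereal (h (norm (x - w))) \<le> R x + ereal (1 / (2 * \<tau>) * (norm (x - w))\<^sup>2)"
    by simp
  then show ?thesis
    unfolding coercive_def
    by (intro tendsto_sandwich[OF _ _ lim tendsto_const]) auto
qed

text \<open>Minimality of p is tested against points on the segment from p to z. The exact formula
  for the squared norm of a convex combination supplies the term in \<open>z - p\<close>; dividing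
  by t and letting t -> 0+ gives its full weight.\<close>

lemma prox_three_point:
  fixes R :: "'a::euclidean_space \<Rightarrow> ereal"
  assumes R: "convex_lsc_proper R"
    and min: "is_arg_min (\<lambda>x. R x + ereal (1 / (2 * \<tau>) * (norm (x - w))\<^sup>2)) (\<lambda>_. True) p"
    and fin: "R p = ereal rp" "R z = ereal rz" and \<tau>: "0 < \<tau>"
  shows "2 * \<tau> * rp + (norm (p - w))\<^sup>2 + (norm (z - p))\<^sup>2 \<le> 2 * \<tau> * rz + (norm (z - w))\<^sup>2"
proof -
  define A B D where "A = (norm (p - w))\<^sup>2 / (2 * \<tau>)" and "B = (norm (z - w))\<^sup>2 / (2 * \<tau>)"
    and "D = (norm (z - p))\<^sup>2 / (2 * \<tau>)"
  have "rp + A + (1 - t) * D \<le> rz + B" if t: "0 < t" "t < 1" for t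
  proof -
    let ?y = "(1 - t) *\<^sub>R p + t *\<^sub>R z"
    have "(norm (?y - w))\<^sup>2 = (1 - t) * (norm (p - w))\<^sup>2 + t * (norm (z - w))\<^sup>2
        - t * (1 - t) * (norm (z - p))\<^sup>2"
      unfolding power2_norm_eq_inner
      by (simp add: inner_diff_left inner_diff_right inner_add_left inner_add_right inner_commute algebra_simps)
    then have sq: "(norm (?y - w))\<^sup>2 / (2 * \<tau>) = (1 - t) * A + t * B - t * (1 - t) * D"
      unfolding A_def B_def D_def by (simp add: add_divide_distrib diff_divide_distrib)
    have "R p + ereal A \<le> R ?y + ereal (1 / (2 * \<tau>) * (norm (?y - w))\<^sup>2)"
      using min by (simp add: is_arg_min_def not_less A_def)
    also have "R ?y \<le> ereal (1 - t) * R p + ereal t * R z"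
      using t R by (simp add: convex_lsc_proper_def)
    finally have "rp + A \<le> (1 - t) * rp + t * rz + ((1 - t) * A + t * B - t * (1 - t) * D)"
      using fin by (simp add: sq add_right_mono)
    then have "t * (rp + A + (1 - t) * D) \<le> t * (rz + B)"
      by (simp add: algebra_simps)
    then show ?thesis
      using t by simp
  qed
  then have "\<forall>\<^sub>F t in at_right 0. rp + A + (1 - t) * D \<le> rz + B"
    using eventually_at_right_real[OF zero_less_one] by (auto elim!: eventually_mono)
  moreover have "((\<lambda>t. rp + A + (1 - t) * D) \<longlongrightarrow> rp + A + (1 - 0) * D) (at_right 0)"
    by (intro tendsto_intros)
  ultimately have "rp + A + (1 - 0) * D \<le> rz + B"
    by (intro tendsto_upperbound) auto
  then have "2 * \<tau> * (rp + A + D) \<le> 2 * \<tau> * (rz + B)"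
    using \<tau> by simp
  then show ?thesis
    using \<tau> by (simp add: A_def B_def D_def distrib_left)
qed

section \<open>Convergence of the inexact forward-backward iteration\<close>

theorem inexact_forward_backward_convergence:
  fixes l :: "'a::euclidean_space \<Rightarrow> real" and R :: "'a \<Rightarrow> ereal"
  assumes convl: "convex_on UNIV l" and der: "\<And>x. GDERIV l x :> g x"
    and lip: "\<And>x y. norm (g x - g y) \<le> \<beta> * norm (x - y)"
    and R: "convex_lsc_proper R" and coer: "coercive (\<lambda>x. ereal (l x) + R x)"
    and \<tau>: "0 < \<tau>" "\<tau> * \<beta> < 1"
    and step: "\<And>k. norm (x (Suc k) - prox \<tau> R (x k - \<tau> *\<^sub>R g (x k))) \<le> e k"
    and e: "summable e"
  shows "\<exists>z. is_arg_min (\<lambda>x. ereal (l x) + R x) (\<lambda>_. True) z \<and> x \<longlonglongrightarrow> z"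
proof -
  let ?F = "\<lambda>x. ereal (l x) + R x"
  have Rm: "R x \<noteq> -\<infinity>" for x
    using R by (simp add: convex_lsc_proper_def)
  have lscR: "seq_lsc R"
    using R by (intro seq_lscI) (simp add: convex_lsc_proper_def)
  obtain x0 where x0: "R x0 \<noteq> \<infinity>"
    using R by (auto simp: convex_lsc_proper_def)
  have contl: "continuous_on UNIV l"
    using der by (auto simp: continuous_on_eq_continuous_at gderiv_def intro: has_derivative_continuous)
  have lscF: "seq_lsc ?F"
    using seq_lsc_add_continuous[OF lscR contl] by (simp add: add.commute)
  obtain z0 where z0: "is_arg_min ?F (\<lambda>_. True) z0"
    using coercive_attains_min[OF lscF coer, of x0] x0 by auto
  have fin: "\<exists>r. R z = ereal r" if "is_arg_min ?F (\<lambda>_. True) z" for z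
    using that x0 Rm[of z] by (cases "R z"; cases "R x0") (auto simp: is_arg_min_def not_less dest!: spec[of _ x0])
  obtain r0 where r0: "R z0 = ereal r0"
    using fin[OF z0] by blast
  \<comment> \<open>The minimum of F is the constant \<open>c\<close> that makes the proximal
    objectives coercive; it reappears when the cluster point is shown optimal.\<close>
  have bd: "ereal (l z0 + r0) \<le> ereal (l x) + R x" for x
    using z0 r0 by (simp add: is_arg_min_def not_less)
  define p where "p k = prox \<tau> R (x k - \<tau> *\<^sub>R g (x k))" for k
  \<comment> \<open>\<open>prox\<close> selects by choice, so it is a minimizer as soon as one
    exists.\<close>
  have pmin: "is_arg_min (\<lambda>y. R y + ereal (1 / (2 * \<tau>) * (norm (y - (x k - \<tau> *\<^sub>R g (x k))))\<^sup>2))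
      (\<lambda>_. True) (p k)" for k
  proof -
    let ?G = "\<lambda>y. R y + ereal (1 / (2 * \<tau>) * (norm (y - (x k - \<tau> *\<^sub>R g (x k))))\<^sup>2)"
    have lsc: "seq_lsc ?G"
      by (intro seq_lsc_add_continuous lscR continuous_intros)
    have coe: "coercive ?G"
      by (rule prox_objective_coercive[OF der lip \<tau> bd])
    have "?G x0 \<noteq> \<infinity>"
      using x0 by simp
    then obtain q where "is_arg_min ?G (\<lambda>_. True) q"
      by (rule coercive_attains_min[OF lsc coe])
    then show ?thesis
      unfolding p_def prox_def arg_min_def by (rule someI[where P = "is_arg_min ?G (\<lambda>_. True)"])
  qed
  have "\<exists>r. R (p k) = ereal r" for k
  proof -
    let ?q = "\<lambda>y. ereal (1 / (2 * \<tau>) * (norm (y - (x k - \<tau> *\<^sub>R g (x k))))\<^sup>2)"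
    have "R (p k) + ?q (p k) \<le> R z0 + ?q z0"
      using pmin[of k] unfolding is_arg_min_def by (meson not_less)
    then show ?thesis
      using Rm[of "p k"] r0 by (cases "R (p k)") auto
  qed
  then obtain rp where rp: "\<And>k. R (p k) = ereal (rp k)"
    by metis
  have key: "2 * \<tau> * ((l (p k) + rp k) - (l z + rz)) + (norm (p k - z))\<^sup>2 + (1 - \<tau> * \<beta>) * (norm (p k - x k))\<^sup>2
      \<le> (norm (x k - z))\<^sup>2" if "R z = ereal rz" for z rz k
  proof -
    \<comment> \<open>Recentring the squares at \<open>x k\<close> produces the same term
      \<open>(norm (\<tau> *\<^sub>R ?g))\<^sup>2\<close> on both sides of \<open>1\<close>. The
      inner products with \<open>?g\<close> cancel against those of the descent and tangent
      inequalities, scaled by \<open>2 * \<tau>\<close>.\<close>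
    let ?a = "p k - x k" and ?b = "z - x k" and ?g = "g (x k)"
    have w: "v - (x k - \<tau> *\<^sub>R ?g) = (v - x k) + \<tau> *\<^sub>R ?g" for v
      by simp
    have 1: "2 * \<tau> * rp k + (norm (?a + \<tau> *\<^sub>R ?g))\<^sup>2 + (norm (z - p k))\<^sup>2
        \<le> 2 * \<tau> * rz + (norm (?b + \<tau> *\<^sub>R ?g))\<^sup>2"
      using prox_three_point[OF R pmin[of k] rp[of k] that \<tau>(1)] unfolding w .
    have 2: "(norm (v + \<tau> *\<^sub>R ?g))\<^sup>2 = (norm v)\<^sup>2 + 2 * \<tau> * (?g \<bullet> v) + (norm (\<tau> *\<^sub>R ?g))\<^sup>2" for v
      unfolding power2_norm_eq_inner by (simp add: inner_add_left inner_add_right inner_commute)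
    have "l (p k) + l (x k) + ?g \<bullet> ?b \<le> l (x k) + ?g \<bullet> ?a + \<beta> / 2 * (norm ?a)\<^sup>2 + l z"
      using descent_lemma[OF der lip, of "p k" "x k"] convex_on_above_tangent[OF convl der, of "x k" z]
      by simp
    then have "2 * \<tau> * (l (p k) + ?g \<bullet> ?b) \<le> 2 * \<tau> * (?g \<bullet> ?a + \<beta> / 2 * (norm ?a)\<^sup>2 + l z)"
      using \<tau>(1) by (intro mult_left_mono) auto
    with 1 show ?thesis
      unfolding 2 by (simp add: algebra_simps norm_minus_commute)
  qed
  have e0: "0 \<le> e k" for k
    using step[of k] norm_ge_zero order_trans by blast
  have elim0: "e \<longlonglongrightarrow> 0"
    by (rule summable_LIMSEQ_zero[OF e])
  have stepp: "norm (x (Suc k) - z) - e k \<le> norm (p k - z)" for k z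
    using step[of k] norm_triangle_ineq[of "x (Suc k) - p k" "p k - z"] by (simp add: p_def)
  have \<kappa>: "1 - \<tau> * \<beta> > 0"
    using \<tau> by simp
  have sq0: "0 \<le> (1 - \<tau> * \<beta>) * (norm (p k - x k))\<^sup>2" for k
    using \<kappa> by simp
  have gap: "0 \<le> 2 * \<tau> * ((l (p k) + rp k) - (l z + rz))"
    if "is_arg_min ?F (\<lambda>_. True) z" "R z = ereal rz" for z rz k
    using that rp[of k] \<tau>(1) by (auto simp: is_arg_min_def not_less dest!: spec[of _ "p k"])
  \<comment> \<open>Passing from squares to norms lets the error enter additively, so that
    summability of e is exactly what the quasi-Fejer argument asks for.\<close>
  have nonexp: "norm (p k - z) \<le> norm (x k - z)"
    if zmin: "is_arg_min ?F (\<lambda>_. True) z" for z k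
  proof -
    obtain rz where "R z = ereal rz"
      using fin[OF zmin] by blast
    then have "(norm (p k - z))\<^sup>2 \<le> (norm (x k - z))\<^sup>2"
      using key[of z rz k] gap[OF zmin, of rz k] sq0[of k] by linarith
    then show ?thesis
      by (rule power2_le_imp_le) simp
  qed
  have dist_conv: "convergent (\<lambda>k. norm (x k - z))" if "is_arg_min ?F (\<lambda>_. True) z" for z
  proof (rule quasi_fejer_convergent[OF _ e0 _ e])
    show "norm (x (Suc k) - z) \<le> norm (x k - z) + e k" for k
      using stepp[of k z] nonexp[OF that, of k] by simp
  qed simp
  obtain d where d: "(\<lambda>k. norm (x k - z0)) \<longlonglongrightarrow> d"
    using dist_conv[OF z0] by (auto simp: convergent_def)
  \<comment> \<open>The distance of \<open>p k\<close> to z0 lies between this sequence and that of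
    \<open>x k\<close>, both with limit d. Hence the two squared distances in \<open>key\<close>
    differ by a null sequence, which controls \<open>p k - x k\<close>.\<close>
  have lower: "(\<lambda>k. norm (x (Suc k) - z0) - e k) \<longlonglongrightarrow> d"
    using tendsto_diff[OF LIMSEQ_Suc[OF d] elim0] by simp
  have "(\<lambda>k. norm (p k - z0)) \<longlonglongrightarrow> d"
    by (rule tendsto_sandwich[OF _ _ lower d]) (intro always_eventually allI stepp nonexp[OF z0])+
  from tendsto_diff[OF tendsto_power[OF d, of 2] tendsto_power[OF this, of 2]]
  have diff0: "(\<lambda>k. (norm (x k - z0))\<^sup>2 - (norm (p k - z0))\<^sup>2) \<longlonglongrightarrow> 0"
    by simp
  have "(\<lambda>k. (1 - \<tau> * \<beta>) * (norm (p k - x k))\<^sup>2) \<longlonglongrightarrow> 0"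
  proof (rule tendsto_sandwich[OF _ _ tendsto_const diff0])
    show "\<forall>\<^sub>F k in sequentially. (1 - \<tau> * \<beta>) * (norm (p k - x k))\<^sup>2
        \<le> (norm (x k - z0))\<^sup>2 - (norm (p k - z0))\<^sup>2"
    proof (intro always_eventually allI)
      show "(1 - \<tau> * \<beta>) * (norm (p k - x k))\<^sup>2 \<le> (norm (x k - z0))\<^sup>2 - (norm (p k - z0))\<^sup>2" for k
        using key[OF r0, of k] gap[OF z0 r0, of k] by linarith
    qed
  qed (use \<kappa> in simp)
  from tendsto_divide[OF this tendsto_const, of "1 - \<tau> * \<beta>"]
  have "(\<lambda>k. (norm (p k - x k))\<^sup>2) \<longlonglongrightarrow> 0"
    using \<kappa> by simp
  then have px: "(\<lambda>k. p k - x k) \<longlonglongrightarrow> 0"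
    using tendsto_real_sqrt[of "\<lambda>k. (norm (p k - x k))\<^sup>2" 0] by (simp add: tendsto_norm_zero_iff)
  have "Bseq (\<lambda>k. norm (x k - z0))"
    using dist_conv[OF z0] by (rule convergent_imp_Bseq)
  then obtain K where K: "\<And>k. norm (x k - z0) \<le> K"
    by (auto simp: Bseq_def)
  have "norm (x k) \<le> K + norm z0" for k
    using K[of k] norm_triangle_ineq2[of "x k" z0] by linarith
  then have "bounded (range x)"
    by (auto simp: bounded_iff)
  then obtain c r where r: "strict_mono r" "(x \<circ> r) \<longlonglongrightarrow> c"
    using bounded_imp_convergent_subsequence by blast
  \<comment> \<open>The cluster point is approached along p: function values are controlled only
    there, and an inexact \<open>x k\<close> may lie where R is infinite.\<close>
  have pc: "(\<lambda>n. p (r n)) \<longlonglongrightarrow> c"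
    using tendsto_add[OF LIMSEQ_subseq_LIMSEQ[OF px r(1)] r(2)] by (simp add: comp_def)
  \<comment> \<open>Upper bounds for F at \<open>p k\<close>, obtained from \<open>key\<close> at z0
    by dropping the last nonnegative term; they tend to the minimum.\<close>
  let ?u = "\<lambda>k. l z0 + r0 + ((norm (x k - z0))\<^sup>2 - (norm (p k - z0))\<^sup>2) / (2 * \<tau>)"
  have "?u \<longlonglongrightarrow> l z0 + r0 + 0 / (2 * \<tau>)"
    by (intro tendsto_intros diff0) (use \<tau> in auto)
  then have "(?u \<circ> r) \<longlonglongrightarrow> l z0 + r0"
    using LIMSEQ_subseq_LIMSEQ[OF _ r(1)] by fastforce
  then have ulim: "(\<lambda>n. ereal (?u (r n))) \<longlonglongrightarrow> ereal (l z0 + r0)"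
    by (simp add: comp_def)
  have "l (p k) + rp k \<le> ?u k" for k
  proof -
    have "2 * \<tau> * ((l (p k) + rp k) - (l z0 + r0)) \<le> (norm (x k - z0))\<^sup>2 - (norm (p k - z0))\<^sup>2"
      using key[OF r0, of k] sq0[of k] by linarith
    then have "(l (p k) + rp k) - (l z0 + r0) \<le> ((norm (x k - z0))\<^sup>2 - (norm (p k - z0))\<^sup>2) / (2 * \<tau>)"
      using \<tau>(1) by (simp add: pos_le_divide_eq mult.commute)
    then show ?thesis
      by linarith
  qed
  then have "\<forall>n. ?F (p (r n)) \<le> ereal (?u (r n))"
    by (simp add: rp)
  then have "?F c \<le> ereal (l z0 + r0)"
    using lscF pc ulim unfolding seq_lsc_def by blast
  then have c: "is_arg_min ?F (\<lambda>_. True) c"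
    using bd by (auto simp: is_arg_min_def not_less intro: order_trans)
  \<comment> \<open>Since c is itself a minimizer, the whole sequence of distances to it converges,
    and a subsequence identifies the limit as 0.\<close>
  obtain d' where d': "(\<lambda>k. norm (x k - c)) \<longlonglongrightarrow> d'"
    using dist_conv[OF c] by (auto simp: convergent_def)
  have "(\<lambda>n. norm (x (r n) - c)) \<longlonglongrightarrow> 0"
    using r(2) by (simp add: comp_def LIM_zero tendsto_norm_zero)
  moreover have "(\<lambda>n. norm (x (r n) - c)) \<longlonglongrightarrow> d'"
    using LIMSEQ_subseq_LIMSEQ[OF d' r(1)] by (simp add: comp_def)
  ultimately have "d' = 0"
    using LIMSEQ_unique by blast
  then have "x \<longlonglongrightarrow> c"
    using d' by (simp add: tendsto_norm_zero_iff LIM_zero_iff)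
  with c show ?thesis
    by blast
qed

section \<open>Reduction of IML FISTA without inertia to the forward-backward iteration\<close>

theorem theorem2p15:
  fixes L\<^sub>h R\<^sub>h :: "real ^ 'n \<Rightarrow> ereal" and L\<^sub>H R\<^sub>H :: "real ^ 'm \<Rightarrow> ereal"
    and R\<^sub>h\<gamma> :: "real ^ 'n \<Rightarrow> real" and R\<^sub>H\<gamma> :: "real ^ 'm \<Rightarrow> real"
    and I\<^sub>h\<^sub>H :: "real ^ 'n \<Rightarrow> real ^ 'm" and I\<^sub>H\<^sub>h :: "real ^ 'm \<Rightarrow> real ^ 'n"
    and \<beta>\<^sub>h \<beta>\<^sub>H \<gamma>\<^sub>h \<gamma>\<^sub>H \<tau>\<^sub>h \<tau>\<^sub>H \<nu> :: real
    and \<Phi> :: "real \<Rightarrow> nat \<Rightarrow> nat \<Rightarrow> real ^ 'm \<Rightarrow> real ^ 'm"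
    and s :: "nat \<Rightarrow> nat \<Rightarrow> real ^ 'm"
    and m p :: nat and C :: "nat set"
    and \<tau>bar \<epsilon> t \<alpha> :: "nat \<Rightarrow> real"
    and x y ybar :: "nat \<Rightarrow> real ^ 'n"
  assumes fine: "convex_lsc_proper L\<^sub>h" "convex_lsc_proper R\<^sub>h"
      "\<beta>\<^sub>h > 0" "differentiable_lipschitz_gradient \<beta>\<^sub>h L\<^sub>h"
      "coercive (\<lambda>z. L\<^sub>h z + R\<^sub>h z)"
    and coarse: "CARD('m) < CARD('n)" "convex_lsc_proper L\<^sub>H" "convex_lsc_proper R\<^sub>H"
      "\<beta>\<^sub>H > 0" "differentiable_lipschitz_gradient \<beta>\<^sub>H L\<^sub>H"
    and transfer: "linear I\<^sub>h\<^sub>H" "linear I\<^sub>H\<^sub>h" "\<nu> > 0" "I\<^sub>H\<^sub>h = (\<lambda>u. \<nu> *\<^sub>R adjoint I\<^sub>h\<^sub>H u)"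
    and smoothing: "\<gamma>\<^sub>h > 0" "smoothed_convex_approx R\<^sub>h \<gamma>\<^sub>h R\<^sub>h\<gamma>"
      "\<gamma>\<^sub>H > 0" "smoothed_convex_approx R\<^sub>H \<gamma>\<^sub>H R\<^sub>H\<gamma>"
    and coarse_iterations: "m > 0"
      "\<forall>k\<in>C. coarse_iterates (\<Phi> \<tau>\<^sub>H k) m (I\<^sub>h\<^sub>H (y k)) (s k)"
      "\<forall>k\<in>C. coarse_model L\<^sub>h R\<^sub>h\<gamma> L\<^sub>H R\<^sub>H\<gamma> I\<^sub>h\<^sub>H (y k) (s k m)
             \<le> coarse_model L\<^sub>h R\<^sub>h\<gamma> L\<^sub>H R\<^sub>H\<gamma> I\<^sub>h\<^sub>H (y k) (s k 0)"
      "bounded ((\<lambda>k. s k m - s k 0) ` C)"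
    and iteration: "\<forall>k\<in>C. \<tau>bar k > 0" "\<forall>k. \<epsilon> k \<ge> 0"
      "t 0 = 1" "\<alpha> 0 = (t 0 - 1) / t 1"
      "iml_fista_type0 L\<^sub>h R\<^sub>h \<tau>\<^sub>h \<epsilon> \<alpha> C \<tau>bar I\<^sub>H\<^sub>h (\<lambda>k. s k m - s k 0) x y ybar"
    and no_inertia: "\<forall>k\<ge>1. \<alpha> k = 0"
    and corrections: "finite C" "card C \<le> p"
    and step_sizes: "0 < \<tau>\<^sub>h" "\<tau>\<^sub>h < inverse \<beta>\<^sub>h" "0 < \<tau>\<^sub>H" "\<tau>\<^sub>H < inverse \<beta>\<^sub>H"
    and errors: "summable (\<lambda>k. sqrt \<bar>\<epsilon> k\<bar>)"
  shows "\<exists>z. is_arg_min (\<lambda>u. L\<^sub>h u + R\<^sub>h u) (\<lambda>_. True) z \<and> x \<longlonglongrightarrow> z"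
proof -
  define l where "l z = real_of_ereal (L\<^sub>h z)" for z
  have L: "L\<^sub>h = (\<lambda>z. ereal (l z))"
    using fine(4) by (auto simp: l_def differentiable_lipschitz_gradient_def ereal_real)
  have g: "egradient L\<^sub>h = gradient l"
    unfolding egradient_def by (simp add: l_def[abs_def])
  have der: "GDERIV l z :> gradient l z" for z
    using fine(4) by (intro gderiv_gradient)
      (simp add: L differentiable_lipschitz_gradient_def differentiable_on_def)
  have lip: "norm (gradient l u - gradient l v) \<le> \<beta>\<^sub>h * norm (u - v)" for u v
    using fine(4) by (auto simp: g differentiable_lipschitz_gradient_def dist_norm dest: lipschitz_onD)
  have "l (u *\<^sub>R a + v *\<^sub>R b) \<le> u * l a + v * l b" if "0 \<le> u" "0 \<le> v" "u + v = 1" for u v a b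
  proof -
    have "L\<^sub>h (u *\<^sub>R a + v *\<^sub>R b) \<le> ereal u * L\<^sub>h a + ereal v * L\<^sub>h b"
      using fine(1) that by (simp add: convex_lsc_proper_def)
    then show ?thesis
      by (simp add: L)
  qed
  then have conv: "convex_on UNIV l"
    by (simp add: convex_on_def)
  \<comment> \<open>For k = 0 the numerator \<open>t 0 - 1\<close> vanishes;
    \<open>no_inertia\<close> starts at 1.\<close>
  have \<alpha>: "\<alpha> k = 0" for k
    using iteration(3,4) no_inertia by (cases "k = 0") auto
  obtain K where K: "\<And>k. k \<in> C \<Longrightarrow> k < K"
    using corrections(1) finite_nat_set_iff_bounded by auto
  \<comment> \<open>From K on there is no correction. The extra successor matters because y equals x
    only at successor indices, \<open>y 0\<close> being arbitrary. Earlier steps merely fix the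
    starting point of this tail.\<close>
  let ?X = "\<lambda>k. x (k + Suc K)"
  have "norm (?X (Suc k) - prox \<tau>\<^sub>h R\<^sub>h (?X k - \<tau>\<^sub>h *\<^sub>R gradient l (?X k)))
      \<le> sqrt (2 * \<tau>\<^sub>h * \<epsilon> (k + Suc K))" for k
  proof -
    have "k + Suc K \<notin> C"
      using K by fastforce
    moreover have "y (Suc j) = x (Suc j)" for j
      using iteration(5) \<alpha> by (simp add: iml_fista_type0_def)
    ultimately have ybar: "ybar (k + Suc K) = ?X k"
      using iteration(5) by (simp add: iml_fista_type0_def)
    have "type0_approx_prox (\<epsilon> j) \<tau>\<^sub>h R\<^sub>h (ybar j - \<tau>\<^sub>h *\<^sub>R gradient l (ybar j)) (x (Suc j))" for j
      using iteration(5) unfolding iml_fista_type0_def g by blast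
    from this[of "k + Suc K"] show ?thesis
      unfolding ybar by (simp add: type0_approx_prox_def)
  qed
  note step = this
  \<comment> \<open>The Type 0 radius is the constant \<open>sqrt (2 * \<tau>\<^sub>h)\<close> times
    the summable square root of the error.\<close>
  have sum: "summable (\<lambda>k. sqrt (2 * \<tau>\<^sub>h * \<epsilon> (k + Suc K)))"
  proof -
    have "summable (\<lambda>k. sqrt (2 * \<tau>\<^sub>h) * sqrt \<bar>\<epsilon> k\<bar>)"
      by (rule summable_mult[OF errors])
    then have "summable (\<lambda>k. sqrt (2 * \<tau>\<^sub>h * \<epsilon> k))"
      using iteration(2) by (simp add: real_sqrt_mult)
    then show ?thesis
      by (rule summable_ignore_initial_segment)
  qed
  have \<tau>\<beta>: "\<tau>\<^sub>h * \<beta>\<^sub>h < 1"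
    using step_sizes(2) fine(3) by (simp add: field_simps)
  have coer: "coercive (\<lambda>z. ereal (l z) + R\<^sub>h z)"
    using fine(5) by (simp add: L)
  obtain z where z: "is_arg_min (\<lambda>z. ereal (l z) + R\<^sub>h z) (\<lambda>_. True) z" "?X \<longlonglongrightarrow> z"
    using inexact_forward_backward_convergence[where x = ?X,
        OF conv der lip fine(2) coer step_sizes(1) \<tau>\<beta> step sum]
    by blast
  then show ?thesis
    using LIMSEQ_offset[OF z(2)] by (auto simp: L)
qed

end
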